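(* Let $\mathcal H$ be a set of functions mapping $\mathcal X\times[d]$ to $\mathbb R^c$. Assume that for all $i=1,\dots,m$, $\Psi_i:\mathbb R^{c\times d}\to\mathbb R$ is $\mu_i$-Lipschitz for $\mathbb R^{c\times d}$ equipped with the $(\infty,2)$-norm for some $\mu_i>0$, that is, $|\Psi_i(\mathbf x')-\Psi_i(\mathbf x)|\le\mu_i\|\mathbf x'-\mathbf x\|_{\infty,2}$ for all $(\mathbf x,\mathbf x')\in(\mathbb R^{c\times d})^2$. Then, for any sample $S$ of $m$ points $x_1,\dots,x_m\in\mathcal X$, there exists a distribution $\mathcal U$ over $[d]^{c\times m}$ such that $$\frac1m\,\mathbb E_{\sigma}\Big[\sup_{\mathbf h\in\mathcal H}\sum_{i=1}^m\sigma_i\Psi_i(\mathbf h(x_i))\Big]\le\frac{\sqrt2}{m}\,\mathbb E_{\upsilon\sim\mathcal U,\,\epsilon}\Big[\sup_{\mathbf h\in\mathcal H}\sum_{i=1}^m\sum_{j=1}^c\epsilon_{ij}\,\mu_i\,h_j(x_i,\upsilon_{ij})\Big],$$ where $\sigma=(\sigma_i)_i$ are independent Rademacher variables, $\epsilon=(\epsilon_{ij})_{i,j}$ with $\epsilon_{ij}$ independent Rademacher variables uniformly distributed over $\{\pm1\}$, and $\upsilon=(\upsilon_{ij})_{i,j}$ is a family of random variables distributed according to $\mathcal U$ (the $\upsilon_{ij}$ themselves need not be independent).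
   Context: For $\mathbf h\in\mathcal H$ and $x\in\mathcal X$, $h_j(x,k)$ denotes the $j$-th coordinate of $\mathbf h(x,k)\in\mathbb R^c$, and $\mathbf h(x)\in\mathbb R^{c\times d}$ denotes the matrix with entries $h_j(x,k)$, $j\in[c]$, $k\in[d]$. The $(\infty,2)$-norm of $\mathbf x=(x_{jk})\in\mathbb R^{c\times d}$ is $\|\mathbf x\|_{\infty,2}=\big(\sum_{j=1}^c\max_{k\in[d]}|x_{jk}|^2\big)^{1/2}$.
   Formalization: The expectation over υ and ε is under some joint law with υ ~ U, ε Rademacher, and (υ_ij)_j independent of (ε_ij)_j for each i; υ_i may depend on ε_l for l ≠ i. With υ fully independent of ε the inequality is false (m=2, c=1, d=4). *)

theory Defs
  imports "HOL-Probability.Probability"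
begin

definition norm_inf_2 :: "real ^ 'd ^ 'c \<Rightarrow> real" where
  "norm_inf_2 X = sqrt (\<Sum>j\<in>UNIV. Max (range (\<lambda>k. \<bar>X $ j $ k\<bar>\<^sup>2)))"

definition value_matrix :: "('x \<times> 'd \<Rightarrow> real ^ 'c) \<Rightarrow> 'x \<Rightarrow> real ^ 'd ^ 'c" where
  "value_matrix h x = (\<chi> j k. h (x, k) $ j)"

definition rademacher :: "('i::finite \<Rightarrow> real) pmf" where
  "rademacher = Pi_pmf UNIV 0 (\<lambda>_. pmf_of_set {-1, 1})"

(* Expectation of an extended-real function under a finitely supported law. It is only
   meant for integrands that do not take both values -\<infinity> and \<infinity>. A supremum over
   H of real values satisfies this: it is nowhere -\<infinity> if H is nonempty, and is
   constantly -\<infinity> if H is empty. *)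
definition ereal_expectation :: "'a pmf \<Rightarrow> ('a \<Rightarrow> ereal) \<Rightarrow> ereal" where
  "ereal_expectation p f = (\<Sum>\<omega>\<in>set_pmf p. ereal (pmf p \<omega>) * f \<omega>)"

(* The joint law P of (upsilon, epsilon) in the expectation over upsilon ~ U and epsilon:
   upsilon has law U, the epsilon_ij are independent Rademacher variables, and for each i
   the families (upsilon_ij)_j and (epsilon_ij)_j are independent of each other.

   P is not required to be the product law: upsilon_i may depend on epsilon_l for l \<noteq> i.
   With the product law the inequality would be false. Take m = 2, c = 1, d = 4,
   mu_1 = mu_2 = 1 and four functions h indexed by p in {-1, 1}^2, such that
   Psi_i(h(x_i)) = p_i. For each i, let the four k enumerate the pairs (p, q) with p_i = 1
   and q_i = -1, and let h(x_i, k) be 1 at p, -1 at q and 0 at the two other indices. Then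
   Psi_i is 1-Lipschitz on the values of h(x_i), hence extends to a 1-Lipschitz function.
   The expectation on the left is 2, while every constant upsilon, hence every law
   independent of epsilon, gives at most 5/4 on the right, and sqrt 2 * 5/4 < 2. *)
definition sampling_law ::
  "('m::finite \<times> 'c::finite \<Rightarrow> 'd) pmf \<Rightarrow>
   (('m \<times> 'c \<Rightarrow> 'd) \<times> ('m \<times> 'c \<Rightarrow> real)) pmf \<Rightarrow> bool" where
  "sampling_law U P \<longleftrightarrow>
     map_pmf fst P = U \<and>
     map_pmf snd P = rademacher \<and>
     (\<forall>i. map_pmf (\<lambda>(\<upsilon>, \<epsilon>). (\<lambda>j. \<upsilon> (i, j), \<lambda>j. \<epsilon> (i, j))) P =
          pair_pmf (map_pmf (\<lambda>\<upsilon> j. \<upsilon> (i, j)) U) rademacher)"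

end

(* Fix for every sign vector sigma a (near) maximizer h^sigma and replace the Psi_i one index at a
   time. Averaging over sigma_i turns sigma_i Psi_i(h(x_i)) into half the difference of Psi_i at the
   maximizers for sigma_i = 1 and sigma_i = -1. The Lipschitz bound, with upsilon_ij the column where
   the entries of the difference matrix D are furthest from 0, and the Khinchine inequality with
   constant sqrt 2 bound it by the average of |sum_j eps_ij D_j,upsilon_ij|. The sign of that sum is an
   odd function of eps_i, hence a uniform sign; letting it play the role of sigma_i undoes the
   averaging and leaves all other terms unchanged. Since upsilon_i depends only on the signs sigma_l
   not yet replaced and on the eps_l already replaced, it stays independent of eps_i, although it
   depends on the other eps_l. There are only finitely many maps eps -> upsilon, so one of them serves
   all choices of near maximizers.

   The Khinchine inequality follows Latala and Oleszkiewicz: f = |sum_j eps_j a_j| is even, so the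
   Laplacian A of the cube has spectral gap 2 on it, while A f <= f by the triangle inequality. *)
theory Submission
  imports Defs
begin

section \<open>Sign vectors and sums over the cube\<close>

definition signs :: "('i \<Rightarrow> real) set" where
  "signs = {\<sigma>. \<forall>i. \<sigma> i \<in> {-1, 1}}"

lemma signsD: "\<sigma> \<in> signs \<Longrightarrow> \<sigma> i = -1 \<or> \<sigma> i = 1"
  by (auto simp: signs_def)

lemma signs_mult_self [simp]: "\<sigma> \<in> signs \<Longrightarrow> \<sigma> i * \<sigma> i = 1"
  using signsD[of \<sigma> i] by auto

lemma signs_eq_PiE: "signs = (UNIV :: 'i set) \<rightarrow>\<^sub>E {-1, 1::real}"
  by (auto simp: signs_def PiE_def Pi_def)

lemma finite_signs [simp]: "finite (signs :: ('i::finite \<Rightarrow> real) set)"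
  by (simp add: signs_eq_PiE finite_PiE)

lemma card_signs: "card (signs :: ('i::finite \<Rightarrow> real) set) = 2 ^ CARD('i)"
  by (simp add: signs_eq_PiE card_PiE numeral_2_eq_2)

lemma one_in_signs [simp]: "(\<lambda>_. 1) \<in> signs"
  by (simp add: signs_def)

lemma signs_nonempty [simp]: "signs \<noteq> {}"
  using one_in_signs by blast

lemma uminus_signs [simp]: "(\<lambda>i. - \<sigma> i) \<in> signs \<longleftrightarrow> \<sigma> \<in> signs"
  by (auto simp: signs_def)

lemma signs_pair: "\<epsilon> \<in> signs \<Longrightarrow> (\<lambda>j. \<epsilon> (i, j)) \<in> signs"
  by (simp add: signs_def)

lemma mult_signs: "\<sigma> \<in> signs \<Longrightarrow> \<delta> \<in> signs \<Longrightarrow> (\<lambda>i. \<sigma> i * \<delta> i) \<in> signs"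
  by (simp add: signs_def) (metis mult.left_neutral mult_minus1 minus_minus)

lemma sum_signs_flip:
  "(\<Sum>\<sigma>\<in>signs. f (\<sigma>(i := - \<sigma> i))) = (\<Sum>\<sigma>\<in>signs. f \<sigma>)"
  by (rule sum.reindex_bij_witness[where i = "\<lambda>\<sigma>. \<sigma>(i := - \<sigma> i)" and j = "\<lambda>\<sigma>. \<sigma>(i := - \<sigma> i)"])
     (auto simp: signs_def)

lemma sum_signs_uminus:
  "(\<Sum>\<sigma>\<in>signs. f (\<lambda>i. - \<sigma> i)) = (\<Sum>\<sigma>\<in>signs. f \<sigma>)"
  by (rule sum.reindex_bij_witness[where i = "\<lambda>\<sigma> i. - \<sigma> i" and j = "\<lambda>\<sigma> i. - \<sigma> i"]) auto


section \<open>The Khinchine inequality with constant \<open>sqrt 2\<close>\<close>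

definition walsh :: "'i set \<Rightarrow> ('i \<Rightarrow> real) \<Rightarrow> real" where
  "walsh T \<delta> = (\<Prod>j\<in>T. \<delta> j)"

definition walsh_coeff :: "(('i \<Rightarrow> real) \<Rightarrow> real) \<Rightarrow> 'i set \<Rightarrow> real" where
  "walsh_coeff f T = (\<Sum>\<delta>\<in>signs. f \<delta> * walsh T \<delta>)"

text \<open>The sum over T is the expansion of the product over j of 1 + \<delta>_j \<delta>'_j, and
  a factor vanishes as soon as the vectors differ in some coordinate.\<close>

lemma walsh_complete:
  fixes \<delta> \<delta>' :: "'i::finite \<Rightarrow> real"
  assumes "\<delta> \<in> signs" "\<delta>' \<in> signs"
  shows "(\<Sum>T\<in>UNIV. walsh T \<delta> * walsh T \<delta>') = (if \<delta> = \<delta>' then 2 ^ CARD('i) else 0)"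
proof -
  have "(\<Sum>T\<in>UNIV. walsh T \<delta> * walsh T \<delta>') = (\<Prod>j\<in>UNIV. \<delta> j * \<delta>' j + 1)"
    by (simp add: prod_add walsh_def prod.distrib)
  also have "\<dots> = (if \<delta> = \<delta>' then 2 ^ CARD('i) else 0)"
  proof (cases "\<delta> = \<delta>'")
    case True
    then show ?thesis using assms by simp
  next
    case False
    then obtain j where "\<delta> j \<noteq> \<delta>' j" by blast
    then have "\<delta> j * \<delta>' j + 1 = 0"
      using signsD[OF assms(1), of j] signsD[OF assms(2), of j] by auto
    then show ?thesis using False by (auto intro!: prod_zero)
  qed
  finally show ?thesis .
qed

text \<open>Summing over T first, \<open>walsh_complete\<close> leaves only the diagonal terms. The
  power of 2 appears because \<open>walsh_coeff\<close> is not normalized.\<close>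

lemma walsh_parseval:
  fixes f g :: "('i::finite \<Rightarrow> real) \<Rightarrow> real"
  shows "(\<Sum>T\<in>UNIV. walsh_coeff f T * walsh_coeff g T) = 2 ^ CARD('i) * (\<Sum>\<delta>\<in>signs. f \<delta> * g \<delta>)"
proof -
  have "(\<Sum>T\<in>UNIV. walsh_coeff f T * walsh_coeff g T)
      = (\<Sum>T\<in>UNIV. \<Sum>\<delta>\<in>signs. \<Sum>\<delta>'\<in>signs. f \<delta> * g \<delta>' * (walsh T \<delta> * walsh T \<delta>'))"
    by (simp add: walsh_coeff_def sum_product mult_ac)
  also have "\<dots> = (\<Sum>\<delta>\<in>signs. \<Sum>T\<in>UNIV. \<Sum>\<delta>'\<in>signs. f \<delta> * g \<delta>' * (walsh T \<delta> * walsh T \<delta>'))"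
    by (rule sum.swap)
  also have "\<dots> = (\<Sum>\<delta>\<in>signs. \<Sum>\<delta>'\<in>signs. \<Sum>T\<in>UNIV. f \<delta> * g \<delta>' * (walsh T \<delta> * walsh T \<delta>'))"
    by (intro sum.cong refl sum.swap)
  also have "\<dots> = (\<Sum>\<delta>\<in>signs. \<Sum>\<delta>'\<in>signs. if \<delta> = \<delta>' then f \<delta> * g \<delta>' * 2 ^ CARD('i) else 0)"
    by (intro sum.cong refl) (simp add: sum_distrib_left[symmetric] walsh_complete)
  also have "\<dots> = 2 ^ CARD('i) * (\<Sum>\<delta>\<in>signs. f \<delta> * g \<delta>)"
    by (simp add: sum_distrib_left mult_ac)
  finally show ?thesis .
qed

lemma walsh_flip:
  fixes \<delta> :: "'i::finite \<Rightarrow> real"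
  shows "walsh T (\<delta>(j := - \<delta> j)) = (if j \<in> T then - walsh T \<delta> else walsh T \<delta>)"
proof (cases "j \<in> T")
  case True
  have "(\<Prod>k\<in>T - {j}. (\<delta>(j := - \<delta> j)) k) = (\<Prod>k\<in>T - {j}. \<delta> k)"
    by (rule prod.cong) auto
  then show ?thesis
    using True by (simp add: walsh_def prod.remove[where x = j])
next
  case False
  then show ?thesis by (auto simp: walsh_def intro!: prod.cong)
qed

text \<open>The flip is a bijection of the cube and can be moved onto the Walsh function. So half
  the difference of f and its flip at j has the coefficient of f if j is in T and 0
  otherwise.\<close>

lemma walsh_coeff_flip:
  fixes f :: "('i::finite \<Rightarrow> real) \<Rightarrow> real"
  shows "walsh_coeff (\<lambda>\<delta>. f (\<delta>(j := - \<delta> j))) T = (if j \<in> T then - walsh_coeff f T else walsh_coeff f T)"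
proof -
  have "walsh_coeff (\<lambda>\<delta>. f (\<delta>(j := - \<delta> j))) T = (\<Sum>\<delta>\<in>signs. f \<delta> * walsh T (\<delta>(j := - \<delta> j)))"
    unfolding walsh_coeff_def
    by (subst sum_signs_flip[where i = j, symmetric]) simp
  then show ?thesis
    by (auto simp: walsh_flip walsh_coeff_def sum_negf)
qed

lemma walsh_coeff_even_odd:
  fixes f :: "('i::finite \<Rightarrow> real) \<Rightarrow> real"
  assumes "\<And>\<delta>. f (\<lambda>i. - \<delta> i) = f \<delta>" "odd (card T)"
  shows "walsh_coeff f T = 0"
proof -
  have "walsh_coeff f T = (\<Sum>\<delta>\<in>signs. f (\<lambda>i. - \<delta> i) * walsh T (\<lambda>i. - \<delta> i))"
    unfolding walsh_coeff_def by (rule sum_signs_uminus[symmetric])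
  also have "\<dots> = - walsh_coeff f T"
    using assms by (simp add: walsh_coeff_def walsh_def prod_uminus sum_negf)
  finally show ?thesis by simp
qed

text \<open>Even functions have no Walsh coefficients on singletons, so the spectral gap is 2 instead of 1.\<close>

lemma poincare_even:
  fixes f :: "('i::finite \<Rightarrow> real) \<Rightarrow> real"
  assumes even: "\<And>\<delta>. f (\<lambda>i. - \<delta> i) = f \<delta>"
  shows "2 * (2 ^ CARD('i) * (\<Sum>\<delta>\<in>signs. (f \<delta>)\<^sup>2) - (\<Sum>\<delta>\<in>signs. f \<delta>)\<^sup>2)
    \<le> 2 ^ CARD('i) * (\<Sum>\<delta>\<in>signs. f \<delta> * (\<Sum>j\<in>UNIV. (f \<delta> - f (\<delta>(j := - \<delta> j))) / 2))"
proof -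
  \<comment> \<open>The Laplacian of the cube; each coordinate in T contributes 1 to its eigenvalue
    on \<open>walsh T\<close>.\<close>
  define A where "A \<delta> = (\<Sum>j\<in>UNIV. (f \<delta> - f (\<delta>(j := - \<delta> j))) / 2)" for \<delta>
  have A: "walsh_coeff A T = real (card T) * walsh_coeff f T" for T
  proof -
    have "walsh_coeff A T = (\<Sum>j\<in>UNIV. (walsh_coeff f T - walsh_coeff (\<lambda>\<delta>. f (\<delta>(j := - \<delta> j))) T) / 2)"
      unfolding A_def walsh_coeff_def
      by (simp add: sum_subtractf[symmetric] sum_divide_distrib sum_distrib_right sum.swap[of _ UNIV signs]
          left_diff_distrib diff_divide_distrib)
    also have "\<dots> = (\<Sum>j\<in>UNIV. if j \<in> T then walsh_coeff f T else 0)"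
      by (intro sum.cong refl) (simp add: walsh_coeff_flip)
    also have "\<dots> = real (card T) * walsh_coeff f T"
      by (simp flip: sum.inter_filter)
    finally show ?thesis .
  qed
  have f0: "walsh_coeff f {} = (\<Sum>\<delta>\<in>signs. f \<delta>)"
    by (simp add: walsh_coeff_def walsh_def)
  have "2 * (2 ^ CARD('i) * (\<Sum>\<delta>\<in>signs. (f \<delta>)\<^sup>2) - (\<Sum>\<delta>\<in>signs. f \<delta>)\<^sup>2)
      = (\<Sum>T\<in>UNIV. 2 * (walsh_coeff f T)\<^sup>2) - 2 * (walsh_coeff f {})\<^sup>2"
    using walsh_parseval[of f f] by (simp add: power2_eq_square f0 sum_distrib_left[symmetric])
  also have "\<dots> = (\<Sum>T\<in>UNIV - {{}}. 2 * (walsh_coeff f T)\<^sup>2)"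
    by (simp add: sum_diff1)
  also have "\<dots> \<le> (\<Sum>T\<in>UNIV - {{}}. walsh_coeff f T * walsh_coeff A T)"
  proof (rule sum_mono)
    fix T :: "'i set" assume "T \<in> UNIV - {{}}"
    then have "card T \<noteq> 0" by simp
    show "2 * (walsh_coeff f T)\<^sup>2 \<le> walsh_coeff f T * walsh_coeff A T"
    proof (cases "odd (card T)")
      case True
      then show ?thesis using walsh_coeff_even_odd[of f T] even by simp
    next
      case False
      with \<open>card T \<noteq> 0\<close> have "2 \<le> card T" by presburger
      then have "2 * (walsh_coeff f T)\<^sup>2 \<le> real (card T) * (walsh_coeff f T)\<^sup>2"
        by (intro mult_right_mono) auto
      then show ?thesis by (simp add: A power2_eq_square mult_ac)
    qed
  qed
  \<comment> \<open>The empty set may be put back because its eigenvalue is 0.\<close>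
  also have "\<dots> = (\<Sum>T\<in>UNIV. walsh_coeff f T * walsh_coeff A T)"
    by (rule sum.mono_neutral_left) (auto simp: A)
  also have "\<dots> = 2 ^ CARD('i) * (\<Sum>\<delta>\<in>signs. f \<delta> * A \<delta>)"
    by (rule walsh_parseval)
  finally show ?thesis by (simp add: A_def)
qed

lemma sum_signs_mult:
  fixes j k :: "'i::finite"
  shows "(\<Sum>\<delta>\<in>signs. \<delta> j * \<delta> k) = (if j = k then 2 ^ CARD('i) else 0)"
proof (cases "j = k")
  case True
  then show ?thesis by (simp add: card_signs)
next
  case False
  then have "(\<Sum>\<delta>\<in>signs. \<delta> j * \<delta> k) = - (\<Sum>\<delta>\<in>signs. \<delta> j * \<delta> k)"
    by (subst sum_signs_flip[where i = j, symmetric]) (simp add: sum_negf)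
  then show ?thesis using False by simp
qed

lemma sum_signs_square:
  fixes a :: "'i::finite \<Rightarrow> real"
  shows "(\<Sum>\<delta>\<in>signs. (\<Sum>j\<in>UNIV. \<delta> j * a j)\<^sup>2) = 2 ^ CARD('i) * (\<Sum>j\<in>UNIV. (a j)\<^sup>2)"
proof -
  have "(\<Sum>\<delta>\<in>signs. (\<Sum>j\<in>UNIV. \<delta> j * a j)\<^sup>2)
      = (\<Sum>\<delta>\<in>signs. \<Sum>j\<in>UNIV. \<Sum>k\<in>UNIV. a j * a k * (\<delta> j * \<delta> k))"
    by (simp add: power2_eq_square sum_product mult_ac)
  also have "\<dots> = (\<Sum>j\<in>UNIV. \<Sum>\<delta>\<in>signs. \<Sum>k\<in>UNIV. a j * a k * (\<delta> j * \<delta> k))"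
    by (rule sum.swap)
  also have "\<dots> = (\<Sum>j\<in>UNIV. \<Sum>k\<in>UNIV. a j * a k * (\<Sum>\<delta>\<in>signs. \<delta> j * \<delta> k))"
    unfolding sum_distrib_left by (intro sum.cong refl sum.swap)
  also have "\<dots> = 2 ^ CARD('i) * (\<Sum>j\<in>UNIV. (a j)\<^sup>2)"
    by (simp add: sum_signs_mult if_distrib sum_distrib_left power2_eq_square mult_ac cong: if_cong)
  finally show ?thesis .
qed

text \<open>With E the average over the cube, \<open>poincare_even\<close> and
  \<open>laplace\<close> give 2 (E f^2 - (E f)^2) <= E f^2, that is E f^2 <= 2 (E f)^2, and E f^2 is
  the sum of the squares of \<open>a\<close>.\<close>

lemma khinchine:
  fixes a :: "'i::finite \<Rightarrow> real"
  shows "2 ^ CARD('i) * sqrt (\<Sum>j\<in>UNIV. (a j)\<^sup>2) \<le> sqrt 2 * (\<Sum>\<delta>\<in>signs. \<bar>\<Sum>j\<in>UNIV. \<delta> j * a j\<bar>)"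
proof -
  define S where "S \<delta> = (\<Sum>j\<in>UNIV. \<delta> j * a j)" for \<delta>
  define f where "f \<delta> = \<bar>S \<delta>\<bar>" for \<delta>
  have even: "f (\<lambda>i. - \<delta> i) = f \<delta>" for \<delta>
    by (simp add: f_def S_def sum_negf)
  have laplace: "(\<Sum>j\<in>UNIV. (f \<delta> - f (\<delta>(j := - \<delta> j))) / 2) \<le> f \<delta>" for \<delta>
  proof -
    have S_flip: "S (\<delta>(j := - \<delta> j)) = S \<delta> - 2 * \<delta> j * a j" for j
    proof -
      have "S \<delta> - S (\<delta>(j := - \<delta> j)) = (\<Sum>k\<in>UNIV. if k = j then 2 * \<delta> j * a j else 0)"
        unfolding S_def sum_subtractf[symmetric] by (rule sum.cong) auto
      then show ?thesis by simp
    qed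
    \<comment> \<open>Each summand of S changes sign under exactly one of the n flips, so the n
      flipped sums add up to (n - 2) S.\<close>
    have "(real CARD('i) - 2) * S \<delta> = (\<Sum>j\<in>UNIV. S (\<delta>(j := - \<delta> j)))"
      by (simp add: S_flip sum_subtractf algebra_simps sum_distrib_left[symmetric])
         (simp add: S_def mult.left_commute[of _ 2] mult.commute[of _ 2] sum_distrib_left)
    then have "\<bar>(real CARD('i) - 2) * S \<delta>\<bar> \<le> (\<Sum>j\<in>UNIV. f (\<delta>(j := - \<delta> j)))"
      by (simp add: f_def)
    \<comment> \<open>Only an inequality, since n - 2 is negative for n = 1.\<close>
    moreover have "(real CARD('i) - 2) * f \<delta> \<le> \<bar>(real CARD('i) - 2) * S \<delta>\<bar>"
      by (simp add: f_def abs_mult mult_right_mono)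
    moreover have "(\<Sum>j\<in>UNIV. (f \<delta> - f (\<delta>(j := - \<delta> j))) / 2)
        = (real CARD('i) * f \<delta> - (\<Sum>j\<in>UNIV. f (\<delta>(j := - \<delta> j)))) / 2"
      by (simp add: sum_divide_distrib[symmetric] sum_subtractf)
    ultimately show ?thesis by (simp add: algebra_simps)
  qed
  let ?N = "2 ^ CARD('i) :: real"
  have "2 * (?N * (\<Sum>\<delta>\<in>signs. (f \<delta>)\<^sup>2) - (\<Sum>\<delta>\<in>signs. f \<delta>)\<^sup>2)
      \<le> ?N * (\<Sum>\<delta>\<in>signs. f \<delta> * (\<Sum>j\<in>UNIV. (f \<delta> - f (\<delta>(j := - \<delta> j))) / 2))"
    by (rule poincare_even[of f, OF even])
  also have "\<dots> \<le> ?N * (\<Sum>\<delta>\<in>signs. f \<delta> * f \<delta>)"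
    by (intro mult_left_mono sum_mono laplace) (auto simp: f_def)
  finally have "?N * (\<Sum>\<delta>\<in>signs. (f \<delta>)\<^sup>2) \<le> 2 * (\<Sum>\<delta>\<in>signs. f \<delta>)\<^sup>2"
    by (simp add: power2_eq_square)
  then have "?N\<^sup>2 * (\<Sum>j\<in>UNIV. (a j)\<^sup>2) \<le> 2 * (\<Sum>\<delta>\<in>signs. f \<delta>)\<^sup>2"
    by (simp add: f_def S_def sum_signs_square power2_eq_square[of ?N] mult.assoc)
  then have "sqrt (?N\<^sup>2 * (\<Sum>j\<in>UNIV. (a j)\<^sup>2)) \<le> sqrt (2 * (\<Sum>\<delta>\<in>signs. f \<delta>)\<^sup>2)"
    by (rule real_sqrt_le_mono)
  moreover have "0 \<le> (\<Sum>\<delta>\<in>signs. f \<delta>)"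
    by (intro sum_nonneg) (simp add: f_def)
  ultimately show ?thesis
    by (simp add: real_sqrt_mult f_def S_def)
qed


section \<open>Replacing the Lipschitz functions one index at a time\<close>

text \<open>Sign changes of row i. Averaging over all \<delta> redraws that row; the constant
  \<delta> = -1 is the reflection that negates odd functions of the row.\<close>

definition twist :: "'m \<Rightarrow> ('c \<Rightarrow> real) \<Rightarrow> ('m \<times> 'c \<Rightarrow> real) \<Rightarrow> 'm \<times> 'c \<Rightarrow> real" where
  "twist i \<delta> \<epsilon> = (\<lambda>(l, j). if l = i then \<delta> j * \<epsilon> (l, j) else \<epsilon> (l, j))"

lemma twist_same [simp]: "twist i \<delta> \<epsilon> (i, j) = \<delta> j * \<epsilon> (i, j)"
  by (simp add: twist_def)

lemma twist_other [simp]: "l \<noteq> i \<Longrightarrow> twist i \<delta> \<epsilon> (l, j) = \<epsilon> (l, j)"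
  by (simp add: twist_def)

lemma twist_signs: "\<delta> \<in> signs \<Longrightarrow> \<epsilon> \<in> signs \<Longrightarrow> twist i \<delta> \<epsilon> \<in> signs"
  using mult_signs by (fastforce simp: signs_def twist_def)

lemma twist_twist: "\<delta> \<in> signs \<Longrightarrow> twist i \<delta> (twist i \<delta> \<epsilon>) = \<epsilon>"
  by (auto simp: twist_def fun_eq_iff mult.assoc[symmetric])

lemma sum_signs_twist:
  "\<delta> \<in> signs \<Longrightarrow> (\<Sum>\<epsilon>\<in>signs. f (twist i \<delta> \<epsilon>)) = (\<Sum>\<epsilon>\<in>signs. f \<epsilon>)"
  by (rule sum.reindex_bij_witness[where i = "twist i \<delta>" and j = "twist i \<delta>"])
     (auto simp: twist_twist twist_signs)

lemma minus_one_in_signs: "(\<lambda>_. -1) \<in> signs"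
  by (simp add: signs_def)

lemma sum_signs_upd:
  fixes F :: "('m::finite \<Rightarrow> real) \<Rightarrow> real"
  shows "(\<Sum>\<sigma>\<in>signs. F (\<sigma>(i := 1)) + F (\<sigma>(i := -1))) = 2 * (\<Sum>\<sigma>\<in>signs. F \<sigma>)"
proof -
  have "(\<Sum>\<sigma>\<in>signs. F (\<sigma>(i := 1)) + F (\<sigma>(i := -1))) = (\<Sum>\<sigma>\<in>signs. F \<sigma> + F (\<sigma>(i := - \<sigma> i)))"
  proof (rule sum.cong[OF refl])
    fix \<sigma> :: "'m \<Rightarrow> real" assume "\<sigma> \<in> signs"
    then consider "\<sigma> i = 1" | "\<sigma> i = -1" using signsD[of \<sigma> i] by auto
    moreover have "F (\<sigma>(i := \<sigma> i)) = F \<sigma>" by simp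
    ultimately show "F (\<sigma>(i := 1)) + F (\<sigma>(i := -1)) = F \<sigma> + F (\<sigma>(i := - \<sigma> i))"
      by cases (simp_all del: fun_upd_triv)
  qed
  then show ?thesis by (simp add: sum.distrib sum_signs_flip[of F])
qed

text \<open>Reflecting row i is a bijection that negates s, so each term may be paired with its
  reflection. Here F may still depend on row i.\<close>

lemma sum_signs_replace:
  fixes F :: "('m::finite \<Rightarrow> real) \<Rightarrow> ('m \<times> 'c::finite \<Rightarrow> real) \<Rightarrow> real"
  assumes s: "\<And>\<sigma> \<epsilon>. \<epsilon> \<in> signs \<Longrightarrow> s \<sigma> \<epsilon> \<in> {-1, 1}"
    and s_odd: "\<And>\<sigma> \<epsilon>. s \<sigma> (twist i (\<lambda>_. -1) \<epsilon>) = - s \<sigma> \<epsilon>"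
  shows "2 * (\<Sum>\<sigma>\<in>signs. \<Sum>\<epsilon>\<in>signs. F (\<sigma>(i := s \<sigma> \<epsilon>)) \<epsilon>)
    = (\<Sum>\<sigma>\<in>signs. \<Sum>\<epsilon>\<in>signs. F (\<sigma>(i := s \<sigma> \<epsilon>)) \<epsilon> + F (\<sigma>(i := - s \<sigma> \<epsilon>)) (twist i (\<lambda>_. -1) \<epsilon>))"
proof -
  have "(\<Sum>\<epsilon>\<in>signs. F (\<sigma>(i := - s \<sigma> \<epsilon>)) (twist i (\<lambda>_. -1) \<epsilon>)) = (\<Sum>\<epsilon>\<in>signs. F (\<sigma>(i := s \<sigma> \<epsilon>)) \<epsilon>)" for \<sigma>
    using sum_signs_twist[OF minus_one_in_signs, of "\<lambda>\<epsilon>. F (\<sigma>(i := s \<sigma> \<epsilon>)) \<epsilon>" i] by (simp add: s_odd)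
  then show ?thesis by (simp add: sum.distrib sum_distrib_left)
qed

text \<open>If \<open>F\<close> ignores the signs \<open>\<epsilon>\<^sub>i\<close>, then averaging over \<open>\<epsilon>\<^sub>i\<close> makes \<open>s\<close> a uniform sign that is
  independent of everything \<open>F\<close> sees.\<close>

lemma sum_signs_replace_invariant:
  fixes F :: "('m::finite \<Rightarrow> real) \<Rightarrow> ('m \<times> 'c::finite \<Rightarrow> real) \<Rightarrow> real"
  assumes s: "\<And>\<sigma> \<epsilon>. \<epsilon> \<in> signs \<Longrightarrow> s \<sigma> \<epsilon> \<in> {-1, 1}"
    and s_odd: "\<And>\<sigma> \<epsilon>. s \<sigma> (twist i (\<lambda>_. -1) \<epsilon>) = - s \<sigma> \<epsilon>"
    and F: "\<And>\<sigma> \<epsilon>. F \<sigma> (twist i (\<lambda>_. -1) \<epsilon>) = F \<sigma> \<epsilon>"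
  shows "(\<Sum>\<sigma>\<in>signs. \<Sum>\<epsilon>\<in>signs. F (\<sigma>(i := s \<sigma> \<epsilon>)) \<epsilon>) = (\<Sum>\<sigma>\<in>signs. \<Sum>\<epsilon>\<in>signs. F \<sigma> \<epsilon>)"
proof -
  have "2 * (\<Sum>\<sigma>\<in>signs. \<Sum>\<epsilon>\<in>signs. F (\<sigma>(i := s \<sigma> \<epsilon>)) \<epsilon>)
      = (\<Sum>\<sigma>\<in>signs. \<Sum>\<epsilon>\<in>signs. F (\<sigma>(i := s \<sigma> \<epsilon>)) \<epsilon> + F (\<sigma>(i := - s \<sigma> \<epsilon>)) \<epsilon>)"
    by (subst sum_signs_replace[where i = i and s = s, OF s s_odd]) (auto simp: F)
  also have "\<dots> = (\<Sum>\<sigma>\<in>signs. \<Sum>\<epsilon>\<in>signs. F (\<sigma>(i := 1)) \<epsilon> + F (\<sigma>(i := -1)) \<epsilon>)"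
  proof (intro sum.cong refl)
    fix \<sigma> \<epsilon> assume "\<epsilon> \<in> (signs :: ('m \<times> 'c \<Rightarrow> real) set)"
    then have "s \<sigma> \<epsilon> = -1 \<or> s \<sigma> \<epsilon> = 1" using s by blast
    then show "F (\<sigma>(i := s \<sigma> \<epsilon>)) \<epsilon> + F (\<sigma>(i := - s \<sigma> \<epsilon>)) \<epsilon> = F (\<sigma>(i := 1)) \<epsilon> + F (\<sigma>(i := -1)) \<epsilon>"
      by auto
  qed
  also have "\<dots> = 2 * (\<Sum>\<sigma>\<in>signs. \<Sum>\<epsilon>\<in>signs. F \<sigma> \<epsilon>)"
    using sum_signs_upd[of "\<lambda>\<sigma>. \<Sum>\<epsilon>\<in>signs. F \<sigma> \<epsilon>" i] by (simp add: sum.distrib)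
  finally show ?thesis by simp
qed

text \<open>The coefficients d are constant on the orbits of the twists. On each orbit
  \<open>khinchine\<close> applies to the signs \<delta> with the coefficients \<epsilon>_ij d_j,
  whose squares are those of d. Summing over the orbits gives back the sum over \<epsilon>.\<close>

lemma khinchine_twist:
  fixes d :: "('m::finite \<times> 'c::finite \<Rightarrow> real) \<Rightarrow> 'c \<Rightarrow> real"
  assumes d: "\<And>\<delta> \<epsilon>. \<delta> \<in> signs \<Longrightarrow> d (twist i \<delta> \<epsilon>) = d \<epsilon>"
  shows "(\<Sum>\<epsilon>\<in>signs. sqrt (\<Sum>j\<in>UNIV. (d \<epsilon> j)\<^sup>2)) \<le> sqrt 2 * (\<Sum>\<epsilon>\<in>signs. \<bar>\<Sum>j\<in>UNIV. \<epsilon> (i, j) * d \<epsilon> j\<bar>)"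
proof -
  let ?N = "2 ^ CARD('c) :: real"
  have "?N * (\<Sum>\<epsilon>\<in>signs. sqrt (\<Sum>j\<in>UNIV. (d \<epsilon> j)\<^sup>2))
      \<le> (\<Sum>\<epsilon>\<in>signs. sqrt 2 * (\<Sum>\<delta>\<in>signs. \<bar>\<Sum>j\<in>UNIV. twist i \<delta> \<epsilon> (i, j) * d (twist i \<delta> \<epsilon>) j\<bar>))"
    unfolding sum_distrib_left
  proof (rule sum_mono)
    fix \<epsilon> :: "'m \<times> 'c \<Rightarrow> real" assume \<epsilon>: "\<epsilon> \<in> signs"
    have "?N * sqrt (\<Sum>j\<in>UNIV. (\<epsilon> (i, j) * d \<epsilon> j)\<^sup>2) \<le>
      sqrt 2 * (\<Sum>\<delta>\<in>signs. \<bar>\<Sum>j\<in>UNIV. \<delta> j * (\<epsilon> (i, j) * d \<epsilon> j)\<bar>)"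
      by (rule khinchine)
    moreover have "(\<epsilon> (i, j))\<^sup>2 = 1" for j
      using \<epsilon> by (simp add: power2_eq_square)
    ultimately show "?N * sqrt (\<Sum>j\<in>UNIV. (d \<epsilon> j)\<^sup>2)
      \<le> (\<Sum>\<delta>\<in>signs. sqrt 2 * \<bar>\<Sum>j\<in>UNIV. twist i \<delta> \<epsilon> (i, j) * d (twist i \<delta> \<epsilon>) j\<bar>)"
      by (simp add: d power_mult_distrib mult.assoc sum_distrib_left)
  qed
  also have "\<dots> = sqrt 2 * (\<Sum>\<delta>\<in>signs. \<Sum>\<epsilon>\<in>signs. \<bar>\<Sum>j\<in>UNIV. twist i \<delta> \<epsilon> (i, j) * d (twist i \<delta> \<epsilon>) j\<bar>)"
    by (subst sum.swap) (simp add: sum_distrib_left)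
  also have "\<dots> = ?N * (sqrt 2 * (\<Sum>\<epsilon>\<in>signs. \<bar>\<Sum>j\<in>UNIV. \<epsilon> (i, j) * d \<epsilon> j\<bar>))"
    by (simp add: sum_signs_twist[of _ "\<lambda>\<epsilon>. \<bar>\<Sum>j\<in>UNIV. \<epsilon> (i, j) * d \<epsilon> j\<bar>"] card_signs
        del: twist_same cong: sum.cong)
  finally show ?thesis by simp
qed

text \<open>With a farthest column chosen in every row, the mixed norm becomes a Euclidean norm,
  which \<open>khinchine_twist\<close> can bound.\<close>

lemma norm_inf_2_attained:
  fixes X :: "real ^ 'd::finite ^ 'c::finite"
  assumes "\<And>j k. \<bar>X $ j $ k\<bar> \<le> \<bar>X $ j $ \<kappa> j\<bar>"
  shows "norm_inf_2 X = sqrt (\<Sum>j\<in>UNIV. (X $ j $ \<kappa> j)\<^sup>2)"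
proof -
  have "Max (range (\<lambda>k. \<bar>X $ j $ k\<bar>\<^sup>2)) = \<bar>X $ j $ \<kappa> j\<bar>\<^sup>2" for j
    by (rule Max_eqI) (use assms in \<open>auto simp: abs_le_square_iff\<close>)
  then show ?thesis by (simp add: norm_inf_2_def)
qed

text \<open>In the hybrid for a set \<open>A\<close> of already replaced indices, \<open>\<sigma>\<close> on the complement of \<open>A\<close> and \<open>\<epsilon>\<close> on \<open>A\<close>
  are free signs; \<open>\<tau>\<close> computes from them the sign vector whose maximizer is used, and \<open>\<upsilon>\<close> the column indices.
  Invariance under all sign twists \<open>\<delta>\<close> of \<open>\<epsilon>\<^sub>i\<close> encodes that \<open>\<upsilon>\<^sub>i\<close> and \<open>\<epsilon>\<^sub>i\<close> are independent.\<close>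

definition hybrid :: "'m set \<Rightarrow> (('m \<Rightarrow> real) \<Rightarrow> ('m \<times> 'c \<Rightarrow> real) \<Rightarrow> 'm \<Rightarrow> real) \<Rightarrow>
    (('m \<Rightarrow> real) \<Rightarrow> ('m \<times> 'c \<Rightarrow> real) \<Rightarrow> 'm \<times> 'c \<Rightarrow> 'd) \<Rightarrow> bool" where
  "hybrid A \<tau> \<upsilon> \<longleftrightarrow>
    (\<forall>\<sigma> \<sigma>' \<epsilon>. (\<forall>l. l \<notin> A \<longrightarrow> \<sigma> l = \<sigma>' l) \<longrightarrow> \<tau> \<sigma> \<epsilon> = \<tau> \<sigma>' \<epsilon> \<and> \<upsilon> \<sigma> \<epsilon> = \<upsilon> \<sigma>' \<epsilon>) \<and>
    (\<forall>\<sigma> \<epsilon> i. \<forall>\<delta>\<in>signs. i \<notin> A \<longrightarrow> \<tau> \<sigma> (twist i \<delta> \<epsilon>) = \<tau> \<sigma> \<epsilon> \<and> \<upsilon> \<sigma> (twist i \<delta> \<epsilon>) = \<upsilon> \<sigma> \<epsilon>) \<and>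
    (\<forall>i\<in>A. \<forall>\<delta>\<in>signs. \<forall>F :: ('c \<Rightarrow> 'd) \<Rightarrow> ('c \<Rightarrow> real) \<Rightarrow> real.
      (\<Sum>\<sigma>\<in>signs. \<Sum>\<epsilon>\<in>signs. F (\<lambda>j. \<upsilon> \<sigma> \<epsilon> (i, j)) (\<lambda>j. \<delta> j * \<epsilon> (i, j))) =
      (\<Sum>\<sigma>\<in>signs. \<Sum>\<epsilon>\<in>signs. F (\<lambda>j. \<upsilon> \<sigma> \<epsilon> (i, j)) (\<lambda>j. \<epsilon> (i, j))))"

text \<open>Here \<open>g \<sigma> i\<close> stands for the value matrix at the i-th point of the
  function selected for \<sigma>. The hybrids lead from the sum with the \<Psi>_i at A = {} to sqrt
  2 times the sum with the sampled columns at A = \<open>UNIV\<close>.\<close>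

definition hybrid_value where
  "hybrid_value \<Psi> \<mu> g A \<tau> \<upsilon> \<sigma> \<epsilon> =
    (\<Sum>i\<in>-A. \<sigma> i * \<Psi> i (g (\<tau> \<sigma> \<epsilon>) i)) +
    sqrt 2 * (\<Sum>i\<in>A. \<Sum>j\<in>UNIV. \<epsilon> (i, j) * \<mu> i * g (\<tau> \<sigma> \<epsilon>) i $ j $ \<upsilon> \<sigma> \<epsilon> (i, j))"

text \<open>Only the term of i is exchanged. The other terms \<open>W\<close> keep their total, and
  both terms of i are compared with \<mu>_i |Z|: this bounds the old one by the Lipschitz and
  Khinchine inequalities and evaluates the new one exactly.\<close>

lemma hybrid_step:
  fixes g :: "('m::finite \<Rightarrow> real) \<Rightarrow> 'm \<Rightarrow> real ^ 'd::finite ^ 'c::finite"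
    and \<Psi> :: "'m \<Rightarrow> real ^ 'd ^ 'c \<Rightarrow> real"
    and \<tau> :: "('m \<Rightarrow> real) \<Rightarrow> ('m \<times> 'c \<Rightarrow> real) \<Rightarrow> 'm \<Rightarrow> real"
  assumes \<mu>: "0 \<le> \<mu> i" and lip: "\<And>X X'. \<bar>\<Psi> i X' - \<Psi> i X\<bar> \<le> \<mu> i * norm_inf_2 (X' - X)"
    and i: "i \<notin> A" and hyb: "hybrid A \<tau> \<upsilon>"
  obtains \<tau>' \<upsilon>' where "hybrid (insert i A) \<tau>' \<upsilon>'"
    "(\<Sum>\<sigma>\<in>signs. \<Sum>\<epsilon>\<in>signs. hybrid_value \<Psi> \<mu> g A \<tau> \<upsilon> \<sigma> \<epsilon>)
      \<le> (\<Sum>\<sigma>\<in>signs. \<Sum>\<epsilon>\<in>signs. hybrid_value \<Psi> \<mu> g (insert i A) \<tau>' \<upsilon>' \<sigma> \<epsilon>)"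
proof -
  have cong: "\<tau> \<sigma> \<epsilon> = \<tau> \<sigma>' \<epsilon>" "\<upsilon> \<sigma> \<epsilon> = \<upsilon> \<sigma>' \<epsilon>" if "\<And>l. l \<notin> A \<Longrightarrow> \<sigma> l = \<sigma>' l" for \<sigma> \<sigma>' \<epsilon>
    using hyb that unfolding hybrid_def by blast+
  have twist [simp]: "\<tau> \<sigma> (twist l \<delta> \<epsilon>) = \<tau> \<sigma> \<epsilon>" "\<upsilon> \<sigma> (twist l \<delta> \<epsilon>) = \<upsilon> \<sigma> \<epsilon>"
    if "l \<notin> A" "\<delta> \<in> signs" for l \<sigma> \<delta> \<epsilon>
    using hyb that unfolding hybrid_def by blast+
  have indep: "(\<Sum>\<sigma>\<in>signs. \<Sum>\<epsilon>\<in>signs. F (\<lambda>j. \<upsilon> \<sigma> \<epsilon> (l, j)) (\<lambda>j. \<delta> j * \<epsilon> (l, j))) =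
      (\<Sum>\<sigma>\<in>signs. \<Sum>\<epsilon>\<in>signs. F (\<lambda>j. \<upsilon> \<sigma> \<epsilon> (l, j)) (\<lambda>j. \<epsilon> (l, j)))"
    if "l \<in> A" "\<delta> \<in> signs" for l \<delta> and F :: "('c \<Rightarrow> 'd) \<Rightarrow> ('c \<Rightarrow> real) \<Rightarrow> real"
    using hyb that unfolding hybrid_def by blast
  define G where "G \<sigma> \<epsilon> = g (\<tau> \<sigma> \<epsilon>) i" for \<sigma> \<epsilon>
  \<comment> \<open>\<open>D\<close> and \<open>\<kappa>\<close> read \<sigma> only outside
    \<open>insert i A\<close> and are unchanged by twists of rows outside A, in particular of row i.
    This makes the new columns independent of \<epsilon>_i.\<close>
  define D where "D \<sigma> \<epsilon> = G (\<sigma>(i := 1)) \<epsilon> - G (\<sigma>(i := -1)) \<epsilon>" for \<sigma> \<epsilon>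
  define \<kappa> where "\<kappa> \<sigma> \<epsilon> j = (SOME k. \<forall>k'. \<bar>D \<sigma> \<epsilon> $ j $ k'\<bar> \<le> \<bar>D \<sigma> \<epsilon> $ j $ k\<bar>)" for \<sigma> \<epsilon> j
  define Z where "Z \<sigma> \<epsilon> = (\<Sum>j\<in>UNIV. \<epsilon> (i, j) * D \<sigma> \<epsilon> $ j $ \<kappa> \<sigma> \<epsilon> j)" for \<sigma> \<epsilon>
  \<comment> \<open>\<open>sgn 0\<close> is not a sign. If Z = 0, an arbitrary entry of row i stands
    in, which is also odd under the reflection of that row.\<close>
  define s where "s \<sigma> \<epsilon> = (if Z \<sigma> \<epsilon> = 0 then \<epsilon> (i, undefined) else sgn (Z \<sigma> \<epsilon>))" for \<sigma> \<epsilon>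
  \<comment> \<open>The sign s takes the place of \<sigma>_i, so that \<sigma> is no longer read at
    i, as the new hybrid requires.\<close>
  define \<tau>' where "\<tau>' \<sigma> \<epsilon> = \<tau> (\<sigma>(i := s \<sigma> \<epsilon>)) \<epsilon>" for \<sigma> \<epsilon>
  define \<upsilon>' where "\<upsilon>' \<sigma> \<epsilon> = (\<lambda>(l, j). if l = i then \<kappa> \<sigma> \<epsilon> j else \<upsilon> (\<sigma>(i := s \<sigma> \<epsilon>)) \<epsilon> (l, j))" for \<sigma> \<epsilon>

  have \<kappa>_max: "\<bar>D \<sigma> \<epsilon> $ j $ k\<bar> \<le> \<bar>D \<sigma> \<epsilon> $ j $ \<kappa> \<sigma> \<epsilon> j\<bar>" for \<sigma> \<epsilon> j k
  proof -
    let ?R = "range (\<lambda>k. \<bar>D \<sigma> \<epsilon> $ j $ k\<bar>)"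
    have "Max ?R \<in> ?R" by (rule Max_in) auto
    then obtain k0 where "Max ?R = \<bar>D \<sigma> \<epsilon> $ j $ k0\<bar>" by blast
    moreover have "\<bar>D \<sigma> \<epsilon> $ j $ k'\<bar> \<le> Max ?R" for k' by (rule Max_ge) auto
    ultimately have "\<exists>k. \<forall>k'. \<bar>D \<sigma> \<epsilon> $ j $ k'\<bar> \<le> \<bar>D \<sigma> \<epsilon> $ j $ k\<bar>" by metis
    then show ?thesis unfolding \<kappa>_def by (rule someI2_ex) blast
  qed
  have D_cong: "D \<sigma> \<epsilon> = D \<sigma>' \<epsilon>" if "\<And>l. l \<notin> insert i A \<Longrightarrow> \<sigma> l = \<sigma>' l" for \<sigma> \<sigma>' \<epsilon>
  proof -
    have "\<tau> (\<sigma>(i := a)) \<epsilon> = \<tau> (\<sigma>'(i := a)) \<epsilon>" for a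
      by (rule cong) (use that in auto)
    then show ?thesis by (simp add: D_def G_def)
  qed
  have D_upd [simp]: "D (\<sigma>(i := a)) \<epsilon> = D \<sigma> \<epsilon>" for \<sigma> \<epsilon> a
    by (rule D_cong) auto
  have D_twist [simp]: "D \<sigma> (twist l \<delta> \<epsilon>) = D \<sigma> \<epsilon>" if "l \<notin> A" "\<delta> \<in> signs" for l \<sigma> \<delta> \<epsilon>
    using that by (simp add: D_def G_def)
  have \<kappa>_upd [simp]: "\<kappa> (\<sigma>(i := a)) \<epsilon> = \<kappa> \<sigma> \<epsilon>" for \<sigma> \<epsilon> a
    by (simp add: \<kappa>_def fun_eq_iff)
  have \<kappa>_twist [simp]: "\<kappa> \<sigma> (twist l \<delta> \<epsilon>) = \<kappa> \<sigma> \<epsilon>" if "l \<notin> A" "\<delta> \<in> signs" for l \<sigma> \<delta> \<epsilon>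
    using that by (simp add: \<kappa>_def fun_eq_iff)
  have s: "s \<sigma> \<epsilon> \<in> {-1, 1}" if "\<epsilon> \<in> signs" for \<sigma> \<epsilon>
    using signsD[OF that, of "(i, undefined)"] by (auto simp: s_def sgn_if)
  have s_odd: "s \<sigma> (twist i (\<lambda>_. -1) \<epsilon>) = - s \<sigma> \<epsilon>" for \<sigma> \<epsilon>
  proof -
    have "Z \<sigma> (twist i (\<lambda>_. -1) \<epsilon>) = - Z \<sigma> \<epsilon>"
      using i by (simp add: Z_def sum_negf)
    then show ?thesis by (simp add: s_def sgn_minus)
  qed
  have s_twist: "s \<sigma> (twist l \<delta> \<epsilon>) = s \<sigma> \<epsilon>" if "l \<notin> insert i A" "\<delta> \<in> signs" for l \<sigma> \<delta> \<epsilon>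
  proof -
    have "i \<noteq> l" using that by auto
    then show ?thesis using that by (simp add: s_def Z_def)
  qed
  have s_Z: "s \<sigma> \<epsilon> * Z \<sigma> \<epsilon> = \<bar>Z \<sigma> \<epsilon>\<bar>" for \<sigma> \<epsilon>
    by (simp add: s_def abs_sgn mult.commute)

  have "hybrid (insert i A) \<tau>' \<upsilon>'"
    unfolding hybrid_def
  proof (intro conjI allI ballI impI)
    fix \<sigma> \<sigma>' :: "'m \<Rightarrow> real" and \<epsilon>
    assume *: "\<forall>l. l \<notin> insert i A \<longrightarrow> \<sigma> l = \<sigma>' l"
    then have D: "D \<sigma> \<epsilon> = D \<sigma>' \<epsilon>" by (intro D_cong) auto
    then have \<kappa>: "\<kappa> \<sigma> \<epsilon> = \<kappa> \<sigma>' \<epsilon>" by (simp add: \<kappa>_def fun_eq_iff)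
    with D have s: "s \<sigma> \<epsilon> = s \<sigma>' \<epsilon>" by (simp add: s_def Z_def)
    show "\<tau>' \<sigma> \<epsilon> = \<tau>' \<sigma>' \<epsilon>"
      unfolding \<tau>'_def s by (rule cong) (use * in auto)
    have "\<upsilon> (\<sigma>(i := s \<sigma>' \<epsilon>)) \<epsilon> = \<upsilon> (\<sigma>'(i := s \<sigma>' \<epsilon>)) \<epsilon>"
      by (rule cong) (use * in auto)
    then show "\<upsilon>' \<sigma> \<epsilon> = \<upsilon>' \<sigma>' \<epsilon>"
      unfolding \<upsilon>'_def s \<kappa> by (simp cong: if_cong)
  next
    fix \<sigma> \<epsilon> l and \<delta> :: "'c \<Rightarrow> real" assume l: "l \<notin> insert i A" and \<delta>: "\<delta> \<in> signs"
    then show "\<tau>' \<sigma> (twist l \<delta> \<epsilon>) = \<tau>' \<sigma> \<epsilon>" "\<upsilon>' \<sigma> (twist l \<delta> \<epsilon>) = \<upsilon>' \<sigma> \<epsilon>"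
      by (simp_all add: \<tau>'_def \<upsilon>'_def s_twist cong: if_cong)
  next
    fix l and \<delta> :: "'c \<Rightarrow> real" and F :: "('c \<Rightarrow> 'd) \<Rightarrow> ('c \<Rightarrow> real) \<Rightarrow> real"
    assume l: "l \<in> insert i A" and \<delta>: "\<delta> \<in> signs"
    show "(\<Sum>\<sigma>\<in>signs. \<Sum>\<epsilon>\<in>signs. F (\<lambda>j. \<upsilon>' \<sigma> \<epsilon> (l, j)) (\<lambda>j. \<delta> j * \<epsilon> (l, j))) =
      (\<Sum>\<sigma>\<in>signs. \<Sum>\<epsilon>\<in>signs. F (\<lambda>j. \<upsilon>' \<sigma> \<epsilon> (l, j)) (\<lambda>j. \<epsilon> (l, j)))"
    proof (cases "l = i")
      case True
      \<comment> \<open>The columns \<open>\<kappa>\<close> do not see row i, so twisting it only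
        permutes the sum over \<epsilon>.\<close>
      have "(\<Sum>\<epsilon>\<in>signs. F (\<kappa> \<sigma> \<epsilon>) (\<lambda>j. \<delta> j * \<epsilon> (i, j))) = (\<Sum>\<epsilon>\<in>signs. F (\<kappa> \<sigma> \<epsilon>) (\<lambda>j. \<epsilon> (i, j)))" for \<sigma>
        using sum_signs_twist[OF \<delta>, of "\<lambda>\<epsilon>. F (\<kappa> \<sigma> \<epsilon>) (\<lambda>j. \<epsilon> (i, j))" i] i \<delta> by simp
      with True show ?thesis by (simp add: \<upsilon>'_def)
    next
      case False
      then have "l \<in> A" using l by simp
      \<comment> \<open>For an old index l, neither row l nor its columns change when row i is
        reflected. Hence s can be exchanged for the free sign \<sigma>_i, and the old independence
        applies.\<close>
      have *: "(\<Sum>\<sigma>\<in>signs. \<Sum>\<epsilon>\<in>signs. F (\<lambda>j. \<upsilon>' \<sigma> \<epsilon> (l, j)) (\<lambda>j. \<delta> j * \<epsilon> (l, j))) =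
        (\<Sum>\<sigma>\<in>signs. \<Sum>\<epsilon>\<in>signs. F (\<lambda>j. \<upsilon> \<sigma> \<epsilon> (l, j)) (\<lambda>j. \<delta> j * \<epsilon> (l, j)))" for \<delta>
        using sum_signs_replace_invariant[where s = s and i = i and
          F = "\<lambda>\<sigma> \<epsilon>. F (\<lambda>j. \<upsilon> \<sigma> \<epsilon> (l, j)) (\<lambda>j. \<delta> j * \<epsilon> (l, j))", OF s s_odd]
          False i by (simp add: \<upsilon>'_def)
      show ?thesis
        using *[of \<delta>] *[of "\<lambda>_. 1"] indep[OF \<open>l \<in> A\<close> \<delta>, of F] by simp
    qed
  qed

  define W where "W \<sigma> \<epsilon> = (\<Sum>l\<in>- insert i A. \<sigma> l * \<Psi> l (g (\<tau> \<sigma> \<epsilon>) l)) +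
    sqrt 2 * (\<Sum>l\<in>A. \<Sum>j\<in>UNIV. \<epsilon> (l, j) * \<mu> l * g (\<tau> \<sigma> \<epsilon>) l $ j $ \<upsilon> \<sigma> \<epsilon> (l, j))" for \<sigma> \<epsilon>
  define K where "K \<sigma> \<epsilon> = \<mu> i * (\<Sum>j\<in>UNIV. \<epsilon> (i, j) * G \<sigma> \<epsilon> $ j $ \<kappa> \<sigma> \<epsilon> j)" for \<sigma> \<epsilon>
  have compl: "- A = insert i (- insert i A)" using i by auto
  have old: "hybrid_value \<Psi> \<mu> g A \<tau> \<upsilon> \<sigma> \<epsilon> = \<sigma> i * \<Psi> i (G \<sigma> \<epsilon>) + W \<sigma> \<epsilon>" for \<sigma> \<epsilon>
    unfolding hybrid_value_def compl W_def G_def by simp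
  have new: "hybrid_value \<Psi> \<mu> g (insert i A) \<tau>' \<upsilon>' \<sigma> \<epsilon> =
    sqrt 2 * K (\<sigma>(i := s \<sigma> \<epsilon>)) \<epsilon> + W (\<sigma>(i := s \<sigma> \<epsilon>)) \<epsilon>" for \<sigma> \<epsilon>
  proof -
    have 1: "(\<Sum>l\<in>- insert i A. \<sigma> l * \<Psi> l (g (\<tau>' \<sigma> \<epsilon>) l))
      = (\<Sum>l\<in>- insert i A. (\<sigma>(i := s \<sigma> \<epsilon>)) l * \<Psi> l (g (\<tau> (\<sigma>(i := s \<sigma> \<epsilon>)) \<epsilon>) l))"
      by (rule sum.cong) (auto simp: \<tau>'_def)
    have 2: "(\<Sum>l\<in>A. \<Sum>j\<in>UNIV. \<epsilon> (l, j) * \<mu> l * g (\<tau>' \<sigma> \<epsilon>) l $ j $ \<upsilon>' \<sigma> \<epsilon> (l, j))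
      = (\<Sum>l\<in>A. \<Sum>j\<in>UNIV. \<epsilon> (l, j) * \<mu> l * g (\<tau> (\<sigma>(i := s \<sigma> \<epsilon>)) \<epsilon>) l $ j $ \<upsilon> (\<sigma>(i := s \<sigma> \<epsilon>)) \<epsilon> (l, j))"
      using i by (intro sum.cong refl) (auto simp: \<tau>'_def \<upsilon>'_def)
    have 3: "(\<Sum>j\<in>UNIV. \<epsilon> (i, j) * \<mu> i * g (\<tau>' \<sigma> \<epsilon>) i $ j $ \<upsilon>' \<sigma> \<epsilon> (i, j)) = K (\<sigma>(i := s \<sigma> \<epsilon>)) \<epsilon>"
      by (simp add: K_def G_def \<tau>'_def \<upsilon>'_def sum_distrib_left mult_ac)
    show ?thesis
      unfolding hybrid_value_def W_def 1 by (simp add: i 2 3 distrib_left)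
  qed
  have W: "(\<Sum>\<sigma>\<in>signs. \<Sum>\<epsilon>\<in>signs. W (\<sigma>(i := s \<sigma> \<epsilon>)) \<epsilon>) = (\<Sum>\<sigma>\<in>signs. \<Sum>\<epsilon>\<in>signs. W \<sigma> \<epsilon>)"
  proof (rule sum_signs_replace_invariant[where s = s and i = i, OF s s_odd])
    fix \<sigma> and \<epsilon> :: "'m \<times> 'c \<Rightarrow> real"
    have "(\<Sum>j\<in>UNIV. twist i (\<lambda>_. -1) \<epsilon> (l, j) * \<mu> l * g (\<tau> \<sigma> \<epsilon>) l $ j $ \<upsilon> \<sigma> \<epsilon> (l, j)) =
      (\<Sum>j\<in>UNIV. \<epsilon> (l, j) * \<mu> l * g (\<tau> \<sigma> \<epsilon>) l $ j $ \<upsilon> \<sigma> \<epsilon> (l, j))" if "l \<in> A" for l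
    proof -
      have "l \<noteq> i" using that i by auto
      then show ?thesis by simp
    qed
    then show "W \<sigma> (twist i (\<lambda>_. -1) \<epsilon>) = W \<sigma> \<epsilon>"
      using i by (simp add: W_def)
  qed
  have K: "2 * (\<Sum>\<sigma>\<in>signs. \<Sum>\<epsilon>\<in>signs. K (\<sigma>(i := s \<sigma> \<epsilon>)) \<epsilon>)
    = (\<Sum>\<sigma>\<in>signs. \<Sum>\<epsilon>\<in>signs. \<mu> i * \<bar>Z \<sigma> \<epsilon>\<bar>)"
  proof -
    \<comment> \<open>The reflection negates both s and \<epsilon>_ij, so the pair yields the
      difference of G at s and at -s. That difference is s D, which gives s Z = |Z|.\<close>
    have "K (\<sigma>(i := s \<sigma> \<epsilon>)) \<epsilon> + K (\<sigma>(i := - s \<sigma> \<epsilon>)) (twist i (\<lambda>_. -1) \<epsilon>) = \<mu> i * \<bar>Z \<sigma> \<epsilon>\<bar>"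
      if "\<epsilon> \<in> signs" for \<sigma> \<epsilon>
    proof -
      have "K (\<sigma>(i := s \<sigma> \<epsilon>)) \<epsilon> + K (\<sigma>(i := - s \<sigma> \<epsilon>)) (twist i (\<lambda>_. -1) \<epsilon>)
        = \<mu> i * (\<Sum>j\<in>UNIV. \<epsilon> (i, j) * (G (\<sigma>(i := s \<sigma> \<epsilon>)) \<epsilon> - G (\<sigma>(i := - s \<sigma> \<epsilon>)) \<epsilon>) $ j $ \<kappa> \<sigma> \<epsilon> j)"
        using i
        by (simp add: K_def G_def sum_negf right_diff_distrib sum_subtractf)
      also have "G (\<sigma>(i := s \<sigma> \<epsilon>)) \<epsilon> - G (\<sigma>(i := - s \<sigma> \<epsilon>)) \<epsilon> = s \<sigma> \<epsilon> *\<^sub>R D \<sigma> \<epsilon>"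
        using s[OF that, of \<sigma>] by (auto simp: D_def)
      also have "\<mu> i * (\<Sum>j\<in>UNIV. \<epsilon> (i, j) * (s \<sigma> \<epsilon> *\<^sub>R D \<sigma> \<epsilon>) $ j $ \<kappa> \<sigma> \<epsilon> j) = \<mu> i * (s \<sigma> \<epsilon> * Z \<sigma> \<epsilon>)"
        by (simp add: Z_def sum_distrib_left mult_ac)
      finally show ?thesis by (simp only: s_Z)
    qed
    then show ?thesis
      by (subst sum_signs_replace[where s = s and i = i and F = K, OF s s_odd]) simp_all
  qed
  have \<Psi>: "2 * (\<Sum>\<sigma>\<in>signs. \<Sum>\<epsilon>\<in>signs. \<sigma> i * \<Psi> i (G \<sigma> \<epsilon>))
    \<le> sqrt 2 * (\<Sum>\<sigma>\<in>signs. \<Sum>\<epsilon>\<in>signs. \<mu> i * \<bar>Z \<sigma> \<epsilon>\<bar>)"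
  proof -
    \<comment> \<open>Pairing the two values of \<sigma>_i creates the difference to which the
      Lipschitz bound applies.\<close>
    have "2 * (\<Sum>\<sigma>\<in>signs. \<Sum>\<epsilon>\<in>signs. \<sigma> i * \<Psi> i (G \<sigma> \<epsilon>))
      = (\<Sum>\<sigma>\<in>signs. \<Sum>\<epsilon>\<in>signs. \<Psi> i (G (\<sigma>(i := 1)) \<epsilon>) - \<Psi> i (G (\<sigma>(i := -1)) \<epsilon>))"
      using sum_signs_upd[of "\<lambda>\<sigma>. \<Sum>\<epsilon>\<in>signs. \<sigma> i * \<Psi> i (G \<sigma> \<epsilon>)" i]
      by (simp add: sum_subtractf sum_negf)
    also have "\<dots> \<le> (\<Sum>\<sigma>\<in>signs. \<Sum>\<epsilon>\<in>signs. \<mu> i * sqrt (\<Sum>j\<in>UNIV. (D \<sigma> \<epsilon> $ j $ \<kappa> \<sigma> \<epsilon> j)\<^sup>2))"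
    proof (intro sum_mono)
      fix \<sigma> :: "'m \<Rightarrow> real" and \<epsilon> :: "'m \<times> 'c \<Rightarrow> real"
      have "\<Psi> i (G (\<sigma>(i := 1)) \<epsilon>) - \<Psi> i (G (\<sigma>(i := -1)) \<epsilon>) \<le> \<mu> i * norm_inf_2 (D \<sigma> \<epsilon>)"
        unfolding D_def using lip abs_le_D1 by blast
      also have "norm_inf_2 (D \<sigma> \<epsilon>) = sqrt (\<Sum>j\<in>UNIV. (D \<sigma> \<epsilon> $ j $ \<kappa> \<sigma> \<epsilon> j)\<^sup>2)"
        by (rule norm_inf_2_attained) (rule \<kappa>_max)
      finally show "\<Psi> i (G (\<sigma>(i := 1)) \<epsilon>) - \<Psi> i (G (\<sigma>(i := -1)) \<epsilon>)
        \<le> \<mu> i * sqrt (\<Sum>j\<in>UNIV. (D \<sigma> \<epsilon> $ j $ \<kappa> \<sigma> \<epsilon> j)\<^sup>2)" .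
    qed
    also have "\<dots> = (\<Sum>\<sigma>\<in>signs. \<mu> i * (\<Sum>\<epsilon>\<in>signs. sqrt (\<Sum>j\<in>UNIV. (D \<sigma> \<epsilon> $ j $ \<kappa> \<sigma> \<epsilon> j)\<^sup>2)))"
      by (simp add: sum_distrib_left)
    also have "\<dots> \<le> (\<Sum>\<sigma>\<in>signs. \<mu> i * (sqrt 2 * (\<Sum>\<epsilon>\<in>signs. \<bar>Z \<sigma> \<epsilon>\<bar>)))"
      unfolding Z_def
      by (intro sum_mono mult_left_mono \<mu> khinchine_twist) (use i in simp)
    also have "\<dots> = sqrt 2 * (\<Sum>\<sigma>\<in>signs. \<Sum>\<epsilon>\<in>signs. \<mu> i * \<bar>Z \<sigma> \<epsilon>\<bar>)"
      by (simp add: sum_distrib_left mult_ac)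
    finally show ?thesis .
  qed
  have "2 * (\<Sum>\<sigma>\<in>signs. \<Sum>\<epsilon>\<in>signs. \<sigma> i * \<Psi> i (G \<sigma> \<epsilon>))
    \<le> 2 * (sqrt 2 * (\<Sum>\<sigma>\<in>signs. \<Sum>\<epsilon>\<in>signs. K (\<sigma>(i := s \<sigma> \<epsilon>)) \<epsilon>))"
    using \<Psi> by (simp add: K[symmetric])
  then have "(\<Sum>\<sigma>\<in>signs. \<Sum>\<epsilon>\<in>signs. hybrid_value \<Psi> \<mu> g A \<tau> \<upsilon> \<sigma> \<epsilon>)
      \<le> (\<Sum>\<sigma>\<in>signs. \<Sum>\<epsilon>\<in>signs. hybrid_value \<Psi> \<mu> g (insert i A) \<tau>' \<upsilon>' \<sigma> \<epsilon>)"
    by (simp add: old new sum.distrib W sum_distrib_left[symmetric])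
  with \<open>hybrid (insert i A) \<tau>' \<upsilon>'\<close> show ?thesis by (rule that)
qed

section \<open>The coupled sampling law\<close>

lemma rademacher_eq: "rademacher = pmf_of_set signs"
proof -
  have "rademacher = pmf_of_set (PiE_dflt UNIV 0 (\<lambda>_ :: 'i::finite. {-1, 1 :: real}))"
    unfolding rademacher_def by (rule Pi_pmf_of_set) auto
  also have "PiE_dflt UNIV 0 (\<lambda>_ :: 'i. {-1, 1 :: real}) = signs"
    by (auto simp: PiE_dflt_def signs_def)
  finally show ?thesis .
qed

lemma set_pmf_rademacher [simp]: "set_pmf rademacher = signs"
  by (simp add: rademacher_eq)

lemma map_rademacher_mult:
  assumes "\<delta> \<in> signs"
  shows "map_pmf (\<lambda>\<epsilon> j. \<epsilon> j * \<delta> j) rademacher = rademacher"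
proof -
  have "bij_betw (\<lambda>\<epsilon> j. \<epsilon> j * \<delta> j) signs signs"
    by (rule bij_betw_byWitness[where f' = "\<lambda>\<epsilon> j. \<epsilon> j * \<delta> j"])
       (use assms in \<open>auto simp: mult.assoc intro: mult_signs\<close>)
  then show ?thesis by (simp add: rademacher_eq map_pmf_of_set_bij_betw)
qed

lemma map_rademacher_eqI:
  fixes h h' :: "('i::finite \<Rightarrow> real) \<Rightarrow> 'b"
  assumes "\<And>F. (\<Sum>\<epsilon>\<in>signs. F (h \<epsilon>) :: real) = (\<Sum>\<epsilon>\<in>signs. F (h' \<epsilon>))"
  shows "map_pmf h rademacher = map_pmf h' rademacher"
proof (rule pmf_eqI)
  have "pmf (map_pmf h rademacher) z = (\<Sum>\<epsilon>\<in>signs. of_bool (h \<epsilon> = z)) / real (card (signs :: ('i \<Rightarrow> real) set))"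
    for z and h :: "('i \<Rightarrow> real) \<Rightarrow> 'b"
    by (simp add: rademacher_eq pmf_map measure_pmf_of_set sum_of_bool_eq vimage_def)
  then show "pmf (map_pmf h rademacher) z = pmf (map_pmf h' rademacher) z" for z
    using assms[of "\<lambda>y. of_bool (y = z)"] by simp
qed

text \<open>Multiply the second component by fresh independent signs \<delta>. By \<open>inv\<close>
  the law stays Q, but given (u, e) the product of \<delta> and e is Rademacher whatever u and e
  are.\<close>

lemma pair_pmf_rademacherI:
  fixes Q :: "('a \<times> ('c::finite \<Rightarrow> real)) pmf"
  assumes inv: "\<And>\<delta>. \<delta> \<in> signs \<Longrightarrow> map_pmf (\<lambda>(u, e). (u, \<lambda>j. \<delta> j * e j)) Q = Q"
    and snd: "snd ` set_pmf Q \<subseteq> signs"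
  shows "Q = pair_pmf (map_pmf fst Q) rademacher"
proof -
  have "Q = bind_pmf (rademacher :: ('c \<Rightarrow> real) pmf) (\<lambda>\<delta>. Q)"
    by simp
  also have "\<dots> = bind_pmf rademacher (\<lambda>\<delta>. map_pmf (\<lambda>(u, e). (u, \<lambda>j. \<delta> j * e j)) Q)"
    by (rule bind_pmf_cong) (simp_all add: inv)
  also have "\<dots> = bind_pmf Q (\<lambda>z. bind_pmf rademacher (\<lambda>\<delta>. return_pmf (fst z, \<lambda>j. \<delta> j * snd z j)))"
    unfolding map_pmf_def by (subst bind_commute_pmf) (simp add: case_prod_unfold)
  also have "\<dots> = bind_pmf Q (\<lambda>z. bind_pmf (map_pmf (\<lambda>\<delta> j. \<delta> j * snd z j) rademacher) (\<lambda>e. return_pmf (fst z, e)))"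
    by (simp add: bind_map_pmf)
  also have "\<dots> = bind_pmf Q (\<lambda>z. bind_pmf rademacher (\<lambda>e. return_pmf (fst z, e)))"
    using snd by (intro bind_pmf_cong refl) (subst map_rademacher_mult, auto)
  also have "\<dots> = pair_pmf (map_pmf fst Q) rademacher"
    by (simp add: pair_pmf_def bind_map_pmf)
  finally show ?thesis .
qed

text \<open>The columns are a deterministic function of \<epsilon>, because no \<sigma>_i is left
  after all replacements.\<close>

definition coupling :: "(('m \<times> 'c \<Rightarrow> real) \<Rightarrow> 'm \<times> 'c \<Rightarrow> 'd) \<Rightarrow>
    (('m::finite \<times> 'c::finite \<Rightarrow> 'd) \<times> ('m \<times> 'c \<Rightarrow> real)) pmf" where
  "coupling \<upsilon> = map_pmf (\<lambda>\<epsilon>. (\<upsilon> \<epsilon>, \<epsilon>)) rademacher"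

text \<open>The hypothesis is the independence clause of \<open>hybrid\<close> freed of \<sigma>;
  \<open>pair_pmf_rademacherI\<close> turns it into a product law for each row. The marginals are
  right by construction.\<close>

lemma sampling_law_coupling:
  fixes \<upsilon> :: "('m::finite \<times> 'c::finite \<Rightarrow> real) \<Rightarrow> 'm \<times> 'c \<Rightarrow> 'd"
  assumes inv: "\<And>i \<delta> F. \<delta> \<in> signs \<Longrightarrow>
    (\<Sum>\<epsilon>\<in>signs. F (\<lambda>j. \<upsilon> \<epsilon> (i, j)) (\<lambda>j. \<delta> j * \<epsilon> (i, j)) :: real) =
    (\<Sum>\<epsilon>\<in>signs. F (\<lambda>j. \<upsilon> \<epsilon> (i, j)) (\<lambda>j. \<epsilon> (i, j)))"
  shows "sampling_law (map_pmf fst (coupling \<upsilon>)) (coupling \<upsilon>)"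
proof -
  have "map_pmf (\<lambda>(\<upsilon>, \<epsilon>). (\<lambda>j. \<upsilon> (i, j), \<lambda>j. \<epsilon> (i, j))) (coupling \<upsilon>)
    = pair_pmf (map_pmf (\<lambda>\<upsilon> j. \<upsilon> (i, j)) (map_pmf fst (coupling \<upsilon>))) rademacher" for i
  proof -
    define Q where "Q = map_pmf (\<lambda>\<epsilon>. (\<lambda>j. \<upsilon> \<epsilon> (i, j), \<lambda>j. \<epsilon> (i, j))) rademacher"
    have "map_pmf (\<lambda>(u, e). (u, \<lambda>j. \<delta> j * e j)) Q = Q" if "\<delta> \<in> signs" for \<delta>
      unfolding Q_def map_pmf_comp
      by (rule map_rademacher_eqI) (use inv[OF that, where i = i and F = "\<lambda>u e. F (u, e)" for F] in simp)
    moreover have "snd ` set_pmf Q \<subseteq> signs"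
      by (auto simp: Q_def signs_pair)
    ultimately have "Q = pair_pmf (map_pmf fst Q) rademacher"
      by (rule pair_pmf_rademacherI)
    then show ?thesis
      by (simp add: Q_def coupling_def map_pmf_comp)
  qed
  then show ?thesis
    by (simp add: sampling_law_def) (simp add: coupling_def map_pmf_comp)
qed

text \<open>\<open>hybrid_step\<close> is iterated over all indices. The selected function on the
  right depends on \<epsilon> through \<tau>, so it can later be bounded by a supremum inside the
  expectation.\<close>

lemma full_replacement:
  fixes g :: "('m::finite \<Rightarrow> real) \<Rightarrow> 'm \<Rightarrow> real ^ 'd::finite ^ 'c::finite"
    and \<Psi> :: "'m \<Rightarrow> real ^ 'd ^ 'c \<Rightarrow> real"
  assumes \<mu>: "\<And>i. 0 \<le> \<mu> i" and lip: "\<And>i X X'. \<bar>\<Psi> i X' - \<Psi> i X\<bar> \<le> \<mu> i * norm_inf_2 (X' - X)"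
  obtains \<upsilon> :: "('m \<times> 'c \<Rightarrow> real) \<Rightarrow> 'm \<times> 'c \<Rightarrow> 'd" and \<tau> where
    "sampling_law (map_pmf fst (coupling \<upsilon>)) (coupling \<upsilon>)"
    "(\<Sum>\<sigma>\<in>signs. \<Sum>i\<in>UNIV. \<sigma> i * \<Psi> i (g \<sigma> i)) / real (card (signs :: ('m \<Rightarrow> real) set)) \<le>
      sqrt 2 * ((\<Sum>\<epsilon>\<in>signs. \<Sum>i\<in>UNIV. \<Sum>j\<in>UNIV. \<epsilon> (i, j) * \<mu> i * g (\<tau> \<epsilon>) i $ j $ \<upsilon> \<epsilon> (i, j)) /
        real (card (signs :: ('m \<times> 'c \<Rightarrow> real) set)))"
proof -
  let ?M = "real (card (signs :: ('m \<Rightarrow> real) set))"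
  let ?N = "real (card (signs :: ('m \<times> 'c \<Rightarrow> real) set))"
  have pos: "?M > 0" "?N > 0" by (simp_all add: card_gt_0_iff)
  \<comment> \<open>The factor \<open>?N\<close> counts the vectors \<epsilon>, which the initial
    sum does not involve.\<close>
  have "\<exists>\<tau> (\<upsilon> :: ('m \<Rightarrow> real) \<Rightarrow> ('m \<times> 'c \<Rightarrow> real) \<Rightarrow> 'm \<times> 'c \<Rightarrow> 'd). hybrid A \<tau> \<upsilon> \<and>
    ?N * (\<Sum>\<sigma>\<in>signs. \<Sum>i\<in>UNIV. \<sigma> i * \<Psi> i (g \<sigma> i)) \<le>
      (\<Sum>\<sigma>\<in>signs. \<Sum>\<epsilon>\<in>signs. hybrid_value \<Psi> \<mu> g A \<tau> \<upsilon> \<sigma> \<epsilon>)" for A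
    using finite[of A]
  proof (induction A rule: finite_induct)
    case empty
    \<comment> \<open>Any columns serve here: for A = {} none are read and the independence clause
      is vacuous.\<close>
    have "hybrid {} (\<lambda>\<sigma> \<epsilon>. \<sigma>) (\<lambda>\<sigma> (\<epsilon> :: 'm \<times> 'c \<Rightarrow> real) _. undefined :: 'd)"
      by (auto simp: hybrid_def)
    moreover have "?N * (\<Sum>\<sigma>\<in>signs. \<Sum>i\<in>UNIV. \<sigma> i * \<Psi> i (g \<sigma> i)) =
      (\<Sum>\<sigma>\<in>signs. \<Sum>\<epsilon>\<in>(signs :: ('m \<times> 'c \<Rightarrow> real) set).
        hybrid_value \<Psi> \<mu> g {} (\<lambda>\<sigma> \<epsilon>. \<sigma>) (\<lambda>_ _ _. undefined) \<sigma> \<epsilon>)"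
      by (simp add: hybrid_value_def sum_distrib_left)
    ultimately show ?case by (intro exI conjI) (assumption, rule eq_refl)
  next
    case (insert i A)
    then obtain \<tau> and \<upsilon> :: "('m \<Rightarrow> real) \<Rightarrow> ('m \<times> 'c \<Rightarrow> real) \<Rightarrow> 'm \<times> 'c \<Rightarrow> 'd" where
      hyb: "hybrid A \<tau> \<upsilon>" and le: "?N * (\<Sum>\<sigma>\<in>signs. \<Sum>i\<in>UNIV. \<sigma> i * \<Psi> i (g \<sigma> i)) \<le>
        (\<Sum>\<sigma>\<in>signs. \<Sum>\<epsilon>\<in>signs. hybrid_value \<Psi> \<mu> g A \<tau> \<upsilon> \<sigma> \<epsilon>)"
      by blast
    obtain \<tau>' and \<upsilon>' :: "('m \<Rightarrow> real) \<Rightarrow> ('m \<times> 'c \<Rightarrow> real) \<Rightarrow> 'm \<times> 'c \<Rightarrow> 'd" where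
      "hybrid (insert i A) \<tau>' \<upsilon>'"
      "(\<Sum>\<sigma>\<in>signs. \<Sum>\<epsilon>\<in>signs. hybrid_value \<Psi> \<mu> g A \<tau> \<upsilon> \<sigma> \<epsilon>)
        \<le> (\<Sum>\<sigma>\<in>signs. \<Sum>\<epsilon>\<in>signs. hybrid_value \<Psi> \<mu> g (insert i A) \<tau>' \<upsilon>' \<sigma> \<epsilon>)"
      using hybrid_step[where g = g and \<mu> = \<mu> and \<Psi> = \<Psi>, OF \<mu> lip insert.hyps(2) hyb] .
    with le show ?case by (intro exI conjI) (assumption, rule order_trans)
  qed
  then obtain \<tau> and \<upsilon> :: "('m \<Rightarrow> real) \<Rightarrow> ('m \<times> 'c \<Rightarrow> real) \<Rightarrow> 'm \<times> 'c \<Rightarrow> 'd" where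
    hyb: "hybrid UNIV \<tau> \<upsilon>" and le: "?N * (\<Sum>\<sigma>\<in>signs. \<Sum>i\<in>UNIV. \<sigma> i * \<Psi> i (g \<sigma> i)) \<le>
      (\<Sum>\<sigma>\<in>signs. \<Sum>\<epsilon>\<in>signs. hybrid_value \<Psi> \<mu> g UNIV \<tau> \<upsilon> \<sigma> \<epsilon>)"
    by blast
  \<comment> \<open>For A = \<open>UNIV\<close> no coordinate of \<sigma> is read, so any \<sigma>
    may be inserted.\<close>
  define \<tau>\<^sub>0 where "\<tau>\<^sub>0 = \<tau> undefined"
  define \<upsilon>\<^sub>0 where "\<upsilon>\<^sub>0 = \<upsilon> undefined"
  have const: "\<tau> \<sigma> = \<tau>\<^sub>0" "\<upsilon> \<sigma> = \<upsilon>\<^sub>0" for \<sigma>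
  proof -
    have "\<tau> \<sigma> \<epsilon> = \<tau> undefined \<epsilon> \<and> \<upsilon> \<sigma> \<epsilon> = \<upsilon> undefined \<epsilon>" for \<epsilon>
      using hyb[unfolded hybrid_def, THEN conjunct1] by blast
    then show "\<tau> \<sigma> = \<tau>\<^sub>0" "\<upsilon> \<sigma> = \<upsilon>\<^sub>0" by (auto simp: fun_eq_iff \<tau>\<^sub>0_def \<upsilon>\<^sub>0_def)
  qed
  have "sampling_law (map_pmf fst (coupling \<upsilon>\<^sub>0)) (coupling \<upsilon>\<^sub>0)"
  proof (rule sampling_law_coupling)
    fix i F and \<delta> :: "'c \<Rightarrow> real" assume "\<delta> \<in> signs"
    then have "(\<Sum>\<sigma>\<in>(signs :: ('m \<Rightarrow> real) set). \<Sum>\<epsilon>\<in>signs. F (\<lambda>j. \<upsilon> \<sigma> \<epsilon> (i, j)) (\<lambda>j. \<delta> j * \<epsilon> (i, j)) :: real) =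
      (\<Sum>\<sigma>\<in>(signs :: ('m \<Rightarrow> real) set). \<Sum>\<epsilon>\<in>signs. F (\<lambda>j. \<upsilon> \<sigma> \<epsilon> (i, j)) (\<lambda>j. \<epsilon> (i, j)))"
      by (rule hyb[unfolded hybrid_def, THEN conjunct2, THEN conjunct2, rule_format, OF UNIV_I])
    then show "(\<Sum>\<epsilon>\<in>signs. F (\<lambda>j. \<upsilon>\<^sub>0 \<epsilon> (i, j)) (\<lambda>j. \<delta> j * \<epsilon> (i, j))) =
      (\<Sum>\<epsilon>\<in>signs. F (\<lambda>j. \<upsilon>\<^sub>0 \<epsilon> (i, j)) (\<lambda>j. \<epsilon> (i, j)))"
      using pos by (simp add: const(2))
  qed
  moreover have "(\<Sum>\<sigma>\<in>signs. \<Sum>i\<in>UNIV. \<sigma> i * \<Psi> i (g \<sigma> i)) / ?M \<le>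
      sqrt 2 * ((\<Sum>\<epsilon>\<in>signs. \<Sum>i\<in>UNIV. \<Sum>j\<in>UNIV.
        \<epsilon> (i, j) * \<mu> i * g (\<tau>\<^sub>0 \<epsilon>) i $ j $ \<upsilon>\<^sub>0 \<epsilon> (i, j)) / ?N)"
    using le pos by (simp add: hybrid_value_def const sum_distrib_left[symmetric] field_simps)
  ultimately show ?thesis by (rule that)
qed

text \<open>Only values on the support of \<open>rademacher\<close> matter, which leaves finitely
  many couplings.\<close>

lemma coupling_restrict: "coupling (restrict \<upsilon> signs) = coupling \<upsilon>"
  unfolding coupling_def by (rule map_pmf_cong) auto

section \<open>Expectations and suprema in the extended reals\<close>

lemma ereal_expectation_rademacher:
  fixes f :: "('i::finite \<Rightarrow> real) \<Rightarrow> ereal"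
  shows "ereal_expectation rademacher f =
    (\<Sum>\<sigma>\<in>signs. ereal (1 / real (card (signs :: ('i \<Rightarrow> real) set))) * f \<sigma>)"
  unfolding ereal_expectation_def by (rule sum.cong) (simp_all add: rademacher_eq)

lemma ereal_expectation_coupling:
  "ereal_expectation (coupling \<upsilon>) f = ereal_expectation rademacher (\<lambda>\<epsilon>. f (\<upsilon> \<epsilon>, \<epsilon>))"
proof -
  have inj: "inj_on (\<lambda>\<epsilon>. (\<upsilon> \<epsilon>, \<epsilon>)) A" for A by (rule inj_onI) simp
  have "pmf (coupling \<upsilon>) (\<upsilon> \<epsilon>, \<epsilon>) = pmf rademacher \<epsilon>" for \<epsilon>
    unfolding coupling_def using pmf_map_inj'[OF inj, of rademacher \<epsilon>] by simp
  then show ?thesis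
    by (simp add: ereal_expectation_def) (simp add: coupling_def sum.reindex[OF inj])
qed

text \<open>The suprema for different a can be approached independently, so a bound for all choice
  functions g bounds their sum. This takes the place of near maximizers and covers infinite suprema
  too.\<close>

lemma sum_SUP_le:
  fixes f :: "'a \<Rightarrow> 'h \<Rightarrow> real"
  assumes "finite A" "H \<noteq> {}"
    and "\<And>g. (\<And>a. g a \<in> H) \<Longrightarrow> ereal (\<Sum>a\<in>A. f a (g a)) \<le> B"
  shows "(\<Sum>a\<in>A. SUP h\<in>H. ereal (f a h)) \<le> B"
  using assms(1,3)
proof (induction A arbitrary: B rule: finite_induct)
  case empty
  obtain h where "h \<in> H" using \<open>H \<noteq> {}\<close> by blast
  then show ?case using empty[of "\<lambda>_. h"] by (simp add: zero_ereal_def)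
next
  case (insert a A)
  define T where "T = (\<Sum>a\<in>A. SUP h\<in>H. ereal (f a h))"
  have not_MInfty: "(SUP h\<in>H. ereal (f a h)) \<noteq> -\<infinity>" for a
  proof -
    obtain h where "h \<in> H" using \<open>H \<noteq> {}\<close> by blast
    then have "ereal (f a h) \<le> (SUP h\<in>H. ereal (f a h))" by (rule SUP_upper)
    then show ?thesis by auto
  qed
  have T: "T \<noteq> -\<infinity>"
    unfolding T_def using \<open>finite A\<close>
    by (induction A rule: finite_induct) (auto simp: ereal_plus_eq_MInfty not_MInfty)
  have "ereal (f a h) + T \<le> B" if "h \<in> H" for h
  proof -
    \<comment> \<open>With h fixed at a, its term moves into the bound; this is why the induction
      keeps B arbitrary.\<close>
    have "T \<le> B - ereal (f a h)"
      unfolding T_def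
    proof (rule insert.IH)
      fix g :: "'a \<Rightarrow> 'h" assume "\<And>a. g a \<in> H"
      then have "ereal (\<Sum>b\<in>insert a A. f b ((g(a := h)) b)) \<le> B"
        using that by (intro insert.prems) auto
      also have "(\<Sum>b\<in>insert a A. f b ((g(a := h)) b)) = (\<Sum>b\<in>A. f b (g b)) + f a h"
        using insert.hyps by (auto intro!: sum.cong)
      finally show "ereal (\<Sum>b\<in>A. f b (g b)) \<le> B - ereal (f a h)"
        by (simp add: ereal_le_minus)
    qed
    then show ?thesis by (simp add: ereal_le_minus add.commute)
  qed
  then have "(SUP h\<in>H. ereal (f a h) + T) \<le> B" by (rule SUP_least)
  then show ?case
    using insert.hyps by (simp add: T_def[symmetric] SUP_ereal_add_left[OF \<open>H \<noteq> {}\<close> T])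
qed

theorem lemma6:
  fixes H :: "('x \<times> 'd::finite \<Rightarrow> real ^ 'c::finite) set"
    and \<Psi> :: "'m::finite \<Rightarrow> real ^ 'd ^ 'c \<Rightarrow> real"
    and \<mu> :: "'m \<Rightarrow> real"
    and x :: "'m \<Rightarrow> 'x"
  assumes "\<And>i. \<mu> i > 0"
    and "\<And>i X X'. \<bar>\<Psi> i X' - \<Psi> i X\<bar> \<le> \<mu> i * norm_inf_2 (X' - X)"
  shows "\<exists>(U :: ('m \<times> 'c \<Rightarrow> 'd) pmf) P. sampling_law U P \<and>
    ereal (1 / real CARD('m)) *
      ereal_expectation rademacher
        (\<lambda>\<sigma>. SUP h\<in>H. ereal (\<Sum>i\<in>UNIV. \<sigma> i * \<Psi> i (value_matrix h (x i))))
    \<le> ereal (sqrt 2 / real CARD('m)) *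
      ereal_expectation P
        (\<lambda>(\<upsilon>, \<epsilon>). SUP h\<in>H. ereal (\<Sum>i\<in>UNIV. \<Sum>j\<in>UNIV.
           \<epsilon> (i, j) * \<mu> i * h (x i, \<upsilon> (i, j)) $ j))"
proof -
  let ?M = "real (card (signs :: ('m \<Rightarrow> real) set))"
  let ?N = "real (card (signs :: ('m \<times> 'c \<Rightarrow> real) set))"
  define L where "L \<sigma> h = (\<Sum>i\<in>UNIV. \<sigma> i * \<Psi> i (value_matrix h (x i)))" for \<sigma> h
  define R where "R = (\<lambda>(\<upsilon>, \<epsilon>) (h :: 'x \<times> 'd \<Rightarrow> real ^ 'c). \<Sum>i\<in>UNIV. \<Sum>j\<in>UNIV. \<epsilon> (i, j) * \<mu> i * h (x i, \<upsilon> (i, j)) $ j)"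
  define r where "r P = ereal_expectation P (\<lambda>z. SUP h\<in>H. ereal (R z h))" for P
  define \<P> :: "(('m \<times> 'c \<Rightarrow> 'd) \<times> ('m \<times> 'c \<Rightarrow> real)) pmf set"
    where "\<P> = {P \<in> range coupling. sampling_law (map_pmf fst P) P}"
  have "range coupling \<subseteq> coupling ` (signs \<rightarrow>\<^sub>E (UNIV :: ('m \<times> 'c \<Rightarrow> 'd) set))"
  proof (rule image_subsetI)
    fix \<upsilon> :: "('m \<times> 'c \<Rightarrow> real) \<Rightarrow> 'm \<times> 'c \<Rightarrow> 'd"
    have "restrict \<upsilon> signs \<in> signs \<rightarrow>\<^sub>E UNIV" by simp
    then show "coupling \<upsilon> \<in> coupling ` (signs \<rightarrow>\<^sub>E UNIV)"
      by (metis coupling_restrict imageI)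
  qed
  then have "finite (range (coupling :: _ \<Rightarrow> (('m \<times> 'c \<Rightarrow> 'd) \<times> ('m \<times> 'c \<Rightarrow> real)) pmf))"
    by (rule finite_subset) (intro finite_imageI finite_PiE, auto)
  then have fin: "finite \<P>"
    by (simp add: \<P>_def)

  \<comment> \<open>P may still depend on g. The guard H \<noteq> {} lets the same statement show
    that \<open>\<P>\<close> is nonempty when H is empty.\<close>
  have selector: "\<exists>P\<in>\<P>. H \<noteq> {} \<longrightarrow> ereal (\<Sum>\<sigma>\<in>signs. L \<sigma> (g \<sigma>) / ?M) \<le> ereal (sqrt 2) * r P"
    if g: "H \<noteq> {} \<Longrightarrow> \<forall>\<sigma>. g \<sigma> \<in> H" for g
  proof -
    obtain \<upsilon> :: "('m \<times> 'c \<Rightarrow> real) \<Rightarrow> 'm \<times> 'c \<Rightarrow> 'd" and \<tau> where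
      law: "sampling_law (map_pmf fst (coupling \<upsilon>)) (coupling \<upsilon>)" and
      le: "(\<Sum>\<sigma>\<in>signs. \<Sum>i\<in>UNIV. \<sigma> i * \<Psi> i (value_matrix (g \<sigma>) (x i))) / ?M \<le>
        sqrt 2 * ((\<Sum>\<epsilon>\<in>signs. \<Sum>i\<in>UNIV. \<Sum>j\<in>UNIV.
          \<epsilon> (i, j) * \<mu> i * value_matrix (g (\<tau> \<epsilon>)) (x i) $ j $ \<upsilon> \<epsilon> (i, j)) / ?N)"
      using full_replacement[where \<mu> = \<mu> and \<Psi> = \<Psi> and g = "\<lambda>\<sigma> i. value_matrix (g \<sigma>) (x i)",
        OF less_imp_le[OF assms(1)] assms(2)] .
    have "coupling \<upsilon> \<in> \<P>"
      using law by (simp add: \<P>_def)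
    moreover have "ereal (\<Sum>\<sigma>\<in>signs. L \<sigma> (g \<sigma>) / ?M) \<le> ereal (sqrt 2) * r (coupling \<upsilon>)" if "H \<noteq> {}"
    proof -
      have "ereal (\<Sum>\<sigma>\<in>signs. L \<sigma> (g \<sigma>) / ?M)
          \<le> ereal (sqrt 2) * ereal (\<Sum>\<epsilon>\<in>signs. 1 / ?N * R (\<upsilon> \<epsilon>, \<epsilon>) (g (\<tau> \<epsilon>)))"
        using le by (simp add: L_def R_def value_matrix_def sum_divide_distrib)
      also have "\<dots> = ereal (sqrt 2) * (\<Sum>\<epsilon>\<in>signs. ereal (1 / ?N) * ereal (R (\<upsilon> \<epsilon>, \<epsilon>) (g (\<tau> \<epsilon>))))"
        by simp
      \<comment> \<open>The function \<open>g (\<tau> \<epsilon>)\<close> lies in H, so it is a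
        candidate in the supremum for \<epsilon>.\<close>
      also have "\<dots> \<le> ereal (sqrt 2) * r (coupling \<upsilon>)"
        unfolding r_def ereal_expectation_coupling ereal_expectation_rademacher
        using g[OF that] by (intro ereal_mult_left_mono sum_mono SUP_upper) auto
      finally show ?thesis .
    qed
    ultimately show ?thesis by blast
  qed
  have "\<exists>P\<in>\<P>. (\<Sum>\<sigma>\<in>signs. ereal (1 / ?M) * (SUP h\<in>H. ereal (L \<sigma> h))) \<le> ereal (sqrt 2) * r P"
  proof (cases "H = {}")
    case True
    \<comment> \<open>For empty H the left side is -\<infinity>, so any law in \<open>\<P>\<close>
      will do.\<close>
    obtain P where "P \<in> \<P>" using selector[of "\<lambda>_. undefined"] True by blast
    moreover have "(\<Sum>\<sigma>\<in>A. -\<infinity> :: ereal) = -\<infinity>" if "finite A" "A \<noteq> {}" for A :: "('m \<Rightarrow> real) set"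
      using that by (induction A rule: finite_ne_induct) auto
    ultimately show ?thesis
      using True by (auto simp: bot_ereal_def card_gt_0_iff)
  next
    case False
    then have "\<P> \<noteq> {}" using selector[of "\<lambda>_. SOME h. h \<in> H"] by (auto simp: some_in_eq)
    \<comment> \<open>Finiteness of \<open>\<P>\<close> removes the dependence on g: a law with the
      largest right-hand side serves all selectors.\<close>
    with fin have "Max (r ` \<P>) \<in> r ` \<P>" by (intro Max_in) auto
    then obtain P where P: "P \<in> \<P>" "Max (r ` \<P>) = r P" by auto
    have "(\<Sum>\<sigma>\<in>signs. SUP h\<in>H. ereal (L \<sigma> h / ?M)) \<le> ereal (sqrt 2) * r P"
    proof (rule sum_SUP_le[OF finite_signs False])
      fix g :: "('m \<Rightarrow> real) \<Rightarrow> _" assume "\<And>\<sigma>. g \<sigma> \<in> H"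
      then obtain P' where P': "P' \<in> \<P>" "ereal (\<Sum>\<sigma>\<in>signs. L \<sigma> (g \<sigma>) / ?M) \<le> ereal (sqrt 2) * r P'"
        using selector[of g] False by blast
      note P'(2)
      also have "r P' \<le> r P"
        using fin P' P(2)[symmetric] by simp
      finally show "ereal (\<Sum>\<sigma>\<in>signs. L \<sigma> (g \<sigma>) / ?M) \<le> ereal (sqrt 2) * r P"
        by (simp add: ereal_mult_left_mono)
    qed
    then show ?thesis
      using P(1) by (auto simp: Sup_ereal_mult_left'[OF False])
  qed
  then obtain P where P: "P \<in> \<P>" and
    le: "(\<Sum>\<sigma>\<in>signs. ereal (1 / ?M) * (SUP h\<in>H. ereal (L \<sigma> h))) \<le> ereal (sqrt 2) * r P" by blast
  have "ereal (1 / real CARD('m)) * (\<Sum>\<sigma>\<in>signs. ereal (1 / ?M) * (SUP h\<in>H. ereal (L \<sigma> h)))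
      \<le> ereal (1 / real CARD('m)) * (ereal (sqrt 2) * r P)"
    by (intro ereal_mult_left_mono le) simp
  also have "\<dots> = ereal (sqrt 2 / real CARD('m)) * r P"
    by (simp add: mult.assoc[symmetric])
  finally have "ereal (1 / real CARD('m)) * ereal_expectation rademacher (\<lambda>\<sigma>. SUP h\<in>H. ereal (L \<sigma> h))
      \<le> ereal (sqrt 2 / real CARD('m)) * r P"
    by (simp add: ereal_expectation_rademacher)
  moreover have "sampling_law (map_pmf fst P) P" using P by (simp add: \<P>_def)
  ultimately show ?thesis
    unfolding L_def r_def R_def case_prod_unfold by blast
qed

end
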